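(* Let $\mathbf{X}$ be a Lévy process in $\mathbb{R}^d$ with finite variation and Lévy measure $\nu$. Then for any measurable set $\Omega\subset\mathbb{R}^d$ of finite Lebesgue measure and finite perimeter $\mathrm{Per}(\Omega)<\infty$ we have $\mathrm{Per}_{\mathbf{X}}(\Omega)<\infty$, where $$\mathrm{Per}_{\mathbf{X}}(\Omega)=\int_\Omega\int_{\Omega^c-x}\nu(dy)\,dx.$$
   Context: A Lévy process in $\mathbb{R}^d$ has characteristic exponent $\psi$, $\mathbb{E}e^{i\langle X_t,\xi\rangle}=e^{-t\psi(\xi)}$, with $$\psi(x)=\langle x,Ax\rangle-i\langle x,\gamma\rangle-\int_{\mathbb{R}^d}\left(e^{i\langle x,y\rangle}-1-i\langle x,y\rangle\mathbf{1}_{\{\|y\|\le1\}}\right)\nu(dy),$$ where $A$ is symmetric non-negative definite, $\gamma\in\mathbb{R}^d$, and $\nu$ is a Lévy measure: $\nu(\{0\})=0$, $\int(1\wedge\|y\|^2)\,\nu(dy)<\infty$. The process has finite variation (on every interval $(0,t)$) if and only if $A=0$ and $\int_{\|x\|\le1}\|x\|\,\nu(dx)<\infty$. The perimeter of a measurable set $\Omega\subset\mathbb{R}^d$ is $$\mathrm{Per}(\Omega)=\sup\left\{\int_{\mathbb{R}^d}\mathbf{1}_\Omega(x)\,\mathrm{div}\,\phi(x)\,dx:\ \phi\in C_c^1(\mathbb{R}^d,\mathbb{R}^d),\ \|\phi\|_\infty\le1\right\}.$$ *)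

theory Defs
  imports "HOL-Probability.Probability"
begin

section \<open>Levy processes\<close>

text \<open>
  Only the values of the process at times \<open>t \<ge> 0\<close> are relevant.
\<close>

locale levy_process = prob_space M for M :: "'w measure" +
  fixes X :: "real \<Rightarrow> 'w \<Rightarrow> real ^ 'd"
  assumes random_variable_X: "\<And>t. 0 \<le> t \<Longrightarrow> random_variable borel (X t)"
    and start_at_zero: "AE \<omega> in M. X 0 \<omega> = 0"
    and indep_increments:
      "\<And>(t :: nat \<Rightarrow> real) n. 0 \<le> t 0 \<Longrightarrow> (\<And>k. k < n \<Longrightarrow> t k \<le> t (Suc k)) \<Longrightarrow>
         indep_vars (\<lambda>_. borel) (\<lambda>k \<omega>. X (t (Suc k)) \<omega> - X (t k) \<omega>) {..<n}"
    and stationary_increments: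
      "\<And>s t. 0 \<le> s \<Longrightarrow> 0 \<le> t \<Longrightarrow>
         distr M borel (\<lambda>\<omega>. X (s + t) \<omega> - X s \<omega>) = distr M borel (X t)"
    and stochastically_continuous:
      "\<And>t \<epsilon>. 0 \<le> t \<Longrightarrow> 0 < \<epsilon> \<Longrightarrow>
         ((\<lambda>s. prob {\<omega> \<in> space M. \<epsilon> < norm (X s \<omega> - X t \<omega>)}) \<longlongrightarrow> 0) (at t within {0..})"
    and cadlag_paths:
      "AE \<omega> in M. (\<forall>t\<ge>0. ((\<lambda>s. X s \<omega>) \<longlongrightarrow> X t \<omega>) (at_right t)) \<and>
                  (\<forall>t>0. \<exists>l. ((\<lambda>s. X s \<omega>) \<longlongrightarrow> l) (at_left t))"

text \<open>
  Bounded variation of a path: the sums of increments along all finite increasing sequences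
  \<open>t 0 \<le> \<dots> \<le> t n\<close> of points of \<open>S\<close> are bounded by a common constant.
\<close>

definition bounded_variation_on :: "real set \<Rightarrow> (real \<Rightarrow> 'a::real_normed_vector) \<Rightarrow> bool" where
  "bounded_variation_on S f \<longleftrightarrow>
     (\<exists>C. \<forall>(t :: nat \<Rightarrow> real) n. (\<forall>k\<le>n. t k \<in> S) \<longrightarrow> (\<forall>k<n. t k \<le> t (Suc k)) \<longrightarrow>
            (\<Sum>k<n. norm (f (t (Suc k)) - f (t k))) \<le> C)"

definition finite_variation :: "'w measure \<Rightarrow> (real \<Rightarrow> 'w \<Rightarrow> 'a::real_normed_vector) \<Rightarrow> bool" where
  "finite_variation M X \<longleftrightarrow> (AE \<omega> in M. \<forall>t>0. bounded_variation_on {0<..<t} (\<lambda>s. X s \<omega>))"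

definition levy_measure :: "(real ^ 'd) measure \<Rightarrow> bool" where
  "levy_measure \<nu> \<longleftrightarrow>
     sets \<nu> = sets borel \<and> emeasure \<nu> {0} = 0 \<and>
     (\<integral>\<^sup>+ y. ennreal (min 1 ((norm y)\<^sup>2)) \<partial>\<nu>) < \<infinity>"

text \<open>
  No factor \<open>1/2\<close> in front of the Gaussian part; the cut-off is the closed unit ball.
\<close>

definition levy_exponent ::
    "real ^ 'd ^ 'd \<Rightarrow> real ^ 'd \<Rightarrow> (real ^ 'd) measure \<Rightarrow> real ^ 'd \<Rightarrow> complex" where
  "levy_exponent A \<gamma> \<nu> x =
     of_real (x \<bullet> (A *v x)) - \<i> * of_real (x \<bullet> \<gamma>)
     - (CLINT y|\<nu>. iexp (x \<bullet> y) - 1 - \<i> * of_real (x \<bullet> y) * indicator (cball 0 1) y)"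

definition has_levy_triplet ::
    "'w measure \<Rightarrow> (real \<Rightarrow> 'w \<Rightarrow> real ^ 'd) \<Rightarrow>
     real ^ 'd ^ 'd \<Rightarrow> real ^ 'd \<Rightarrow> (real ^ 'd) measure \<Rightarrow> bool" where
  "has_levy_triplet M X A \<gamma> \<nu> \<longleftrightarrow>
     transpose A = A \<and> (\<forall>x. 0 \<le> x \<bullet> (A *v x)) \<and> levy_measure \<nu> \<and>
     (\<forall>t\<ge>0. \<forall>\<xi>. (CLINT \<omega>|M. iexp (X t \<omega> \<bullet> \<xi>)) = exp (- of_real t * levy_exponent A \<gamma> \<nu> \<xi>))"

definition has_levy_measure ::
    "'w measure \<Rightarrow> (real \<Rightarrow> 'w \<Rightarrow> real ^ 'd) \<Rightarrow> (real ^ 'd) measure \<Rightarrow> bool" where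
  "has_levy_measure M X \<nu> \<longleftrightarrow> (\<exists>A \<gamma>. has_levy_triplet M X A \<gamma> \<nu>)"

section \<open>Perimeters\<close>

definition C1_compact_support :: "(real ^ 'd \<Rightarrow> real ^ 'd) \<Rightarrow> bool" where
  "C1_compact_support \<phi> \<longleftrightarrow>
     \<phi> differentiable_on UNIV \<and> continuous_on UNIV (\<lambda>x. jacobian \<phi> (at x)) \<and>
     compact (closure {x. \<phi> x \<noteq> 0})"

definition divergence :: "(real ^ 'd \<Rightarrow> real ^ 'd) \<Rightarrow> real ^ 'd \<Rightarrow> real" where
  "divergence \<phi> x = trace (jacobian \<phi> (at x))"

definition perimeter :: "(real ^ 'd) set \<Rightarrow> ereal" where
  "perimeter \<Omega> =
     (SUP \<phi>\<in>{\<phi>. C1_compact_support \<phi> \<and> (\<forall>x. norm (\<phi> x) \<le> 1)}.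
        ereal (LINT x|lebesgue. indicator \<Omega> x * divergence \<phi> x))"

text \<open>
  The perimeter induced by a process depends on it only through its Levy measure \<open>\<nu>\<close>. The set
  \<open>\<Omega>\<close> is allowed to be Lebesgue measurable, whereas \<open>\<nu>\<close> lives on the Borel sets. The translates
  \<open>-\<Omega> - x\<close> are then measurable with respect to the completion of \<open>\<nu>\<close> for Lebesgue-almost every
  \<open>x\<close> (if \<open>\<nu>\<close> is sigma-finite), so the completion makes the inner integral meaningful; for Borel
  \<open>\<Omega>\<close> it changes nothing.
\<close>

definition levy_perimeter :: "(real ^ 'd) measure \<Rightarrow> (real ^ 'd) set \<Rightarrow> ennreal" where
  "levy_perimeter \<nu> \<Omega> =
     (\<integral>\<^sup>+ x\<in>\<Omega>. (\<integral>\<^sup>+ y\<in>(\<lambda>z. z - x) ` (- \<Omega>). 1 \<partial>completion \<nu>) \<partial>lebesgue)"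

end

(*
  Write f for the indicator of Omega. Translating a test function u along y and differentiating
  in the translation parameter turns the integral of (f(x) - f(x + y)) u(x) into integrals of f
  against divergences of fields of norm at most |y|, so the set of those x in Omega with x + y
  outside Omega has measure at most min(|Omega|, |y| Per(Omega)). By Tonelli the Levy perimeter is
  the nu-integral of this measure, and it remains to see that min(1, |y|) is nu-integrable.

  For this let g(u) be the sum over k of 2^-k (1 - cos(2^k u)), which is at most min(4, 5|u|) and at
  least c|u| for |u| <= 1. Since the variation is finite, sums of g over the coordinates of the
  increments of mesh 1/n are bounded with positive probability, whence n E g(X_{1/n}^i) is bounded
  in n. As n E(1 - cos<xi, X_{1/n}>) tends to Re psi(xi), which dominates the nu-integral of
  1 - cos<xi, y>, the nu-integral of g(y_i) is finite.
*)
theory Submission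
  imports Defs
begin

section \<open>Dyadic cosine sums comparable to the absolute value\<close>

text \<open>A partial sum of the series \<open>g\<close>. Its integrals are finite combinations of
  integrals of \<open>1 - cos\<close>, which the characteristic function controls, and the upper
  bounds below are uniform in \<open>K\<close>.\<close>

definition dyadic_oscillation :: "nat \<Rightarrow> real \<Rightarrow> real" where
  "dyadic_oscillation K u = (\<Sum>k<K. (1 - cos (2 ^ k * u)) / 2 ^ k)"

text \<open>Drives the inductions on \<open>K\<close> below. Since the argument doubles, they have
  to run for all \<open>u\<close> at once.\<close>

lemma dyadic_oscillation_Suc:
  "dyadic_oscillation (Suc K) u = (1 - cos u) + dyadic_oscillation K (2 * u) / 2"
  unfolding dyadic_oscillation_def
  by (simp add: sum.lessThan_Suc_shift sum_divide_distrib mult_ac del: sum.lessThan_Suc)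

lemma dyadic_oscillation_nonneg: "0 \<le> dyadic_oscillation K u"
  unfolding dyadic_oscillation_def by (intro sum_nonneg) auto

lemma dyadic_oscillation_mono: "K \<le> L \<Longrightarrow> dyadic_oscillation K u \<le> dyadic_oscillation L u"
  unfolding dyadic_oscillation_def by (intro sum_mono2) auto

text \<open>In the recursion, 4 is the fixed point of b \<mapsto> 2 + b / 2, where 2 bounds 1 -
  cos.\<close>

lemma dyadic_oscillation_le_4: "dyadic_oscillation K u \<le> 4"
proof (induction K arbitrary: u)
  case 0
  then show ?case by (simp add: dyadic_oscillation_def)
next
  case (Suc K)
  show ?case using Suc[of "2 * u"] cos_ge_minus_one[of u] unfolding dyadic_oscillation_Suc by linarith
qed

lemma one_minus_cos_le: "1 - cos u \<le> u\<^sup>2 / 2" for u :: real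
proof -
  have "(sin (u / 2))\<^sup>2 \<le> (u / 2)\<^sup>2"
    using abs_sin_x_le_abs_x[of "u / 2"] abs_le_square_iff by blast
  then show ?thesis using cos_double_sin[of "u / 2"] by (simp add: power_divide)
qed

lemma dyadic_oscillation_le_linear: "dyadic_oscillation K u \<le> 5 * \<bar>u\<bar>"
proof -
  \<comment> \<open>The quadratic correction absorbs \<open>1 - cos u \<le> u\<^sup>2 / 2\<close> in the induction step.\<close>
  have "\<bar>u\<bar> \<le> 1 \<Longrightarrow> dyadic_oscillation K u \<le> 5 * \<bar>u\<bar> - u\<^sup>2"
  proof (induction K arbitrary: u)
    case 0
    have "u\<^sup>2 \<le> \<bar>u\<bar>" using 0 mult_left_le[of "\<bar>u\<bar>" "\<bar>u\<bar>"] by (simp add: power2_eq_square)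
    then show ?case using 0 by (simp add: dyadic_oscillation_def)
  next
    case (Suc K)
    show ?case
    proof (cases "\<bar>u\<bar> \<le> 1 / 2")
      case True
      then have "dyadic_oscillation K (2 * u) \<le> 5 * \<bar>2 * u\<bar> - (2 * u)\<^sup>2" by (intro Suc.IH) auto
      then show ?thesis using one_minus_cos_le[of u]
        unfolding dyadic_oscillation_Suc by (simp add: abs_mult power_mult_distrib) (use zero_le_power2[of u] in linarith)
    next
      case False
      \<comment> \<open>Over [1/2, 1] the square lies below its chord. This makes the remaining
        comparison of u^2 / 2 + 2 with 5 |u| - u^2 linear in |u|.\<close>
      have "(\<bar>u\<bar> - 1 / 2) * (1 - \<bar>u\<bar>) \<ge> 0" using False Suc.prems by (intro mult_nonneg_nonneg) auto
      then have "u\<^sup>2 \<le> 3 / 2 * \<bar>u\<bar> - 1 / 2" by (simp add: field_simps power2_eq_square)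
      moreover have "dyadic_oscillation (Suc K) u \<le> u\<^sup>2 / 2 + 2"
        using dyadic_oscillation_le_4[of K "2 * u"] one_minus_cos_le[of u]
        by (simp add: dyadic_oscillation_Suc)
      ultimately show ?thesis using False by linarith
    qed
  qed
  \<comment> \<open>For |u| > 1 this constant is already below 5 |u|.\<close>
  moreover have "dyadic_oscillation K u \<le> 4" by (rule dyadic_oscillation_le_4)
  moreover have "0 \<le> u\<^sup>2" by simp
  ultimately show ?thesis by linarith
qed

text \<open>One term is enough: some \<open>N\<close> satisfies 1 \<le> 2^N |u| \<le> 2. There 1 -
  cos is at least 1 - cos 1, because 2 \<le> pi, and the weight 2^-N is at least |u| / 2. The index
  depends on \<open>u\<close>.\<close>

lemma dyadic_oscillation_ge_linear:
  assumes "\<bar>u\<bar> \<le> 1"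
  obtains K where "(1 - cos 1) / 2 * \<bar>u\<bar> \<le> dyadic_oscillation K u"
proof (cases "u = 0")
  case True
  then show ?thesis using that[of 0] by (simp add: dyadic_oscillation_def)
next
  case False
  obtain n :: nat where n: "1 / \<bar>u\<bar> < 2 ^ n" using real_arch_pow[of 2 "1 / \<bar>u\<bar>"] by auto
  define N where "N = (LEAST n. 1 \<le> 2 ^ n * \<bar>u\<bar>)"
  have ex: "1 \<le> 2 ^ n * \<bar>u\<bar>" using n False by (simp add: field_simps)
  have N1: "1 \<le> 2 ^ N * \<bar>u\<bar>" unfolding N_def by (rule LeastI[of _ n]) (rule ex)
  have N2: "2 ^ N * \<bar>u\<bar> \<le> 2"
  proof (cases N)
    case (Suc m)
    have "\<not> 1 \<le> 2 ^ m * \<bar>u\<bar>" using not_less_Least[of m "\<lambda>n. 1 \<le> 2 ^ n * \<bar>u\<bar>"] Suc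
      unfolding N_def by simp
    then show ?thesis using Suc by simp
  qed (use assms in simp)
  have "cos (2 ^ N * u) = cos (2 ^ N * \<bar>u\<bar>)"
    using cos_abs_real[of "2 ^ N * u"] by (simp add: abs_mult)
  also have "\<dots> \<le> cos 1" using N1 N2 pi_ge_two by (intro cos_monotone_0_pi_le) auto
  finally have c: "1 - cos 1 \<le> 1 - cos (2 ^ N * u)" by simp
  have "(1 - cos 1) / 2 * \<bar>u\<bar> \<le> (1 - cos 1) / 2 ^ N"
    using mult_left_mono[of "\<bar>u\<bar>" "2 / 2 ^ N" "(1 - cos 1) / 2"] N2 by (simp add: field_simps)
  also have "\<dots> \<le> (1 - cos (2 ^ N * u)) / 2 ^ N" using c by (intro divide_right_mono) auto
  also have "\<dots> \<le> dyadic_oscillation (Suc N) u"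
    unfolding dyadic_oscillation_def
    by (rule member_le_sum[of N "{..<Suc N}" "\<lambda>k. (1 - cos (2 ^ k * u)) / 2 ^ k"]) auto
  finally show ?thesis by (rule that)
qed

lemma borel_measurable_dyadic_oscillation [measurable]:
  "dyadic_oscillation K \<in> borel_measurable borel"
  unfolding dyadic_oscillation_def by measurable

section \<open>Increments of a process of finite variation over short times\<close>

text \<open>Converts a lower bound on the Laplace transform of a variable with values in [0, 1] into
  an upper bound on its mean.\<close>

lemma exp_minus_le_half: "0 \<le> x \<Longrightarrow> x \<le> 1 \<Longrightarrow> exp (- x) \<le> 1 - x / 2" for x :: real
proof -
  assume x: "0 \<le> x" "x \<le> 1"
  have "exp (- x) = 1 / exp x" by (simp add: exp_minus inverse_eq_divide)
  also have "\<dots> \<le> 1 / (1 + x)" using x exp_ge_add_one_self[of x] by (intro divide_left_mono) auto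
  also have "\<dots> \<le> 1 - x / 2" using x mult_left_le[of x x] by (simp add: field_simps)
  finally show ?thesis .
qed

text \<open>
  If the sums of the increments over the partitions of mesh \<open>1 / (n + 1)\<close> stay bounded with
  positive probability, then the Laplace transforms of these sums stay away from \<open>0\<close>; by
  independence and stationarity each one is an \<open>n\<close>-th power.
\<close>

lemma (in levy_process) finite_variation_bounded_rate:
  assumes fv: "finite_variation M X" and "0 \<le> L"
  obtains C where "\<And>f n. f \<in> borel_measurable borel \<Longrightarrow> (\<And>x. 0 \<le> f x) \<Longrightarrow> (\<And>x. f x \<le> 1) \<Longrightarrow>
    (\<And>x. f x \<le> L * norm x) \<Longrightarrow> real n * expectation (\<lambda>\<omega>. f (X (1 / real (Suc n)) \<omega>)) \<le> C"
proof -
  \<comment> \<open>The shift by one in the numerator keeps the points away from 0, as the variation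
    is controlled on open intervals only: for k \<le> n they lie in (0, 1], hence in (0, 2). The
    shift in the denominator admits n = 0.\<close>
  define t where "t n k = real (Suc k) / real (Suc n)" for n k
  define D where "D n k \<omega> = X (t n (Suc k)) \<omega> - X (t n k) \<omega>" for n k \<omega>
  \<comment> \<open>One constant serves all partitions at once. With natural constants, countably
    many events cover almost every path, so one of them has positive probability.\<close>
  define E where "E (C::nat) = {\<omega>\<in>space M. \<forall>n. (\<Sum>k<n. norm (D n k \<omega>)) \<le> real C}" for C
  have Xm [measurable]: "X s \<in> borel_measurable M" if "0 \<le> s" for s
    using random_variable_X[OF that] by simp
  have t0: "0 \<le> t n k" for n k by (simp add: t_def)
  have Dm [measurable]: "D n k \<in> borel_measurable M" for n k
    unfolding D_def by (intro borel_measurable_diff Xm t0)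
  have Em [measurable]: "E C \<in> events" for C
    unfolding E_def by measurable
  have "AE \<omega> in M. \<exists>C. \<omega> \<in> E C"
    using fv AE_space unfolding finite_variation_def
  proof eventually_elim
    case (elim \<omega>)
    then obtain C where C: "\<And>(s :: nat \<Rightarrow> real) n. (\<forall>k\<le>n. s k \<in> {0<..<2}) \<Longrightarrow> (\<forall>k<n. s k \<le> s (Suc k)) \<Longrightarrow>
            (\<Sum>k<n. norm (X (s (Suc k)) \<omega> - X (s k) \<omega>)) \<le> C"
      unfolding bounded_variation_on_def by (meson zero_less_numeral)
    obtain C' :: nat where C': "C \<le> real C'" using real_arch_simple by blast
    have "(\<Sum>k<n. norm (D n k \<omega>)) \<le> C" for n
      unfolding D_def
    proof (rule C[of n "t n"])
      show "\<forall>k\<le>n. t n k \<in> {0<..<2}" by (auto simp: t_def field_simps)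
      show "\<forall>k<n. t n k \<le> t n (Suc k)" by (auto simp: t_def field_simps)
    qed
    then have "\<omega> \<in> E C'" using elim C' unfolding E_def by (auto intro: order_trans)
    then show ?case by blast
  qed
  then have "emeasure M (\<Union>C. E C) = 1"
    by (intro emeasure_eq_1_AE) auto
  then obtain C where C: "emeasure M (E C) \<noteq> 0"
    using emeasure_UN_eq_0[of M E] Em by (auto simp: image_subset_iff)
  define p where "p = prob (E C)"
  have p: "0 < p" using C unfolding p_def by (simp add: emeasure_eq_measure zero_less_measure_iff)
  \<comment> \<open>The bound comes from taking logarithms in p exp (- L C) \<le> (E exp (- f (X
    h)))^n \<le> exp (- n E f (X h) / 2). It depends on \<open>f\<close> only through
    \<open>L\<close>.\<close>
  have "real n * expectation (\<lambda>\<omega>. f (X (1 / real (Suc n)) \<omega>)) \<le> 2 * (L * C - ln p)"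
    if fm [measurable]: "f \<in> borel_measurable borel" and f0: "\<And>x. 0 \<le> f x" and f1: "\<And>x. f x \<le> 1"
      and fL: "\<And>x. f x \<le> L * norm x" for f n
  proof -
    define h where "h = 1 / real (Suc n)"
    have h [measurable]: "X h \<in> borel_measurable M" by (rule Xm) (simp add: h_def)
    have ef: "0 \<le> exp (- f x)" "exp (- f x) \<le> 1" for x using f0 by auto
    have int_ef: "integrable M (\<lambda>\<omega>. exp (- f (Y \<omega>)))" if [measurable]: "Y \<in> borel_measurable M" for Y
      by (rule integrable_const_bound[of _ 1]) (use ef in auto)
    have int_f: "integrable M (\<lambda>\<omega>. f (X h \<omega>))"
      by (rule integrable_const_bound[of _ 1]) (use f0 f1 in auto)
    have iv: "indep_vars (\<lambda>_. borel) (\<lambda>k \<omega>. exp (- f (D n k \<omega>))) {..<n}"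
    proof (rule indep_vars_compose2[where M'="\<lambda>_. borel" and Y="\<lambda>k x. exp (- f x)"])
      show "indep_vars (\<lambda>_. borel) (D n) {..<n}"
        unfolding D_def by (rule indep_increments) (auto simp: t_def field_simps)
    qed measurable
    have same: "expectation (\<lambda>\<omega>. exp (- f (D n k \<omega>))) = expectation (\<lambda>\<omega>. exp (- f (X h \<omega>)))" for k
    proof -
      have "t n (Suc k) = t n k + h" by (simp add: t_def h_def field_simps)
      then have "distr M borel (D n k) = distr M borel (X h)"
        unfolding D_def using stationary_increments[OF t0[of n k], of h] by (simp add: h_def)
      moreover have "expectation (\<lambda>\<omega>. exp (- f (D n k \<omega>))) = integral\<^sup>L (distr M borel (D n k)) (\<lambda>x. exp (- f x))"
        by (subst integral_distr) auto
      moreover have "expectation (\<lambda>\<omega>. exp (- f (X h \<omega>))) = integral\<^sup>L (distr M borel (X h)) (\<lambda>x. exp (- f x))"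
        by (subst integral_distr) auto
      ultimately show ?thesis by simp
    qed
    have "p * exp (- (L * C)) = expectation (\<lambda>\<omega>. exp (- (L * C)) * indicator (E C) \<omega>)"
      by (simp add: p_def)
    also have "\<dots> \<le> expectation (\<lambda>\<omega>. \<Prod>k<n. exp (- f (D n k \<omega>)))"
    proof (rule integral_mono)
      show "integrable M (\<lambda>\<omega>. exp (- (L * C)) * indicator (E C) \<omega>)"
        by (intro integrable_mult_right integrable_real_indicator) (auto simp: emeasure_eq_measure)
      show "integrable M (\<lambda>\<omega>. \<Prod>k<n. exp (- f (D n k \<omega>)))"
        using ef by (intro integrable_const_bound[of _ 1]) (auto simp: abs_prod intro!: prod_le_1)
      fix \<omega>
      show "exp (- (L * C)) * indicator (E C) \<omega> \<le> (\<Prod>k<n. exp (- f (D n k \<omega>)))"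
      proof (cases "\<omega> \<in> E C")
        case True
        have "(\<Sum>k<n. f (D n k \<omega>)) \<le> L * (\<Sum>k<n. norm (D n k \<omega>))"
          unfolding sum_distrib_left by (intro sum_mono fL)
        also have "\<dots> \<le> L * C" using True \<open>0 \<le> L\<close> by (intro mult_left_mono) (auto simp: E_def)
        finally show ?thesis using True by (simp add: exp_sum[symmetric] sum_negf)
      qed (use ef in \<open>auto intro!: prod_nonneg\<close>)
    qed
    also have "\<dots> = (\<Prod>k<n. expectation (\<lambda>\<omega>. exp (- f (D n k \<omega>))))"
      by (rule indep_vars_lebesgue_integral[OF _ iv]) (auto intro!: int_ef)
    also have "\<dots> = expectation (\<lambda>\<omega>. exp (- f (X h \<omega>))) ^ n" by (simp add: same)
    also have "\<dots> \<le> exp (- expectation (\<lambda>\<omega>. f (X h \<omega>)) / 2) ^ n"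
    proof (rule power_mono)
      have "expectation (\<lambda>\<omega>. exp (- f (X h \<omega>))) \<le> expectation (\<lambda>\<omega>. 1 - f (X h \<omega>) / 2)"
        using int_f f0 f1 by (intro integral_mono int_ef exp_minus_le_half) auto
      also have "\<dots> = 1 - expectation (\<lambda>\<omega>. f (X h \<omega>)) / 2"
        using int_f by (simp add: prob_space)
      also have "\<dots> \<le> exp (- expectation (\<lambda>\<omega>. f (X h \<omega>)) / 2)"
        using exp_ge_add_one_self[of "- expectation (\<lambda>\<omega>. f (X h \<omega>)) / 2"] by simp
      finally show "expectation (\<lambda>\<omega>. exp (- f (X h \<omega>))) \<le> exp (- expectation (\<lambda>\<omega>. f (X h \<omega>)) / 2)" .
    qed (auto intro!: integral_nonneg)
    also have "\<dots> = exp (- (real n * expectation (\<lambda>\<omega>. f (X h \<omega>)) / 2))"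
      by (simp add: exp_of_nat_mult[symmetric])
    finally have "ln (p * exp (- (L * C))) \<le> ln (exp (- (real n * expectation (\<lambda>\<omega>. f (X h \<omega>)) / 2)))"
      using p by (intro ln_mono) auto
    then show ?thesis using p by (simp add: ln_mult h_def)
  qed
  then show ?thesis by (rule that)
qed

section \<open>Integrals against a Levy measure and the characteristic exponent\<close>

lemma levy_measure_sets: "levy_measure \<nu> \<Longrightarrow> sets \<nu> = sets borel"
  by (simp add: levy_measure_def)

lemma levy_measure_integrable_bound:
  fixes f :: "real ^ 'd \<Rightarrow> 'b :: {banach, second_countable_topology}"
  assumes \<nu>: "levy_measure \<nu>" and f: "f \<in> borel_measurable borel"
    and bnd: "\<And>y. norm (f y) \<le> C * min 1 ((norm y)\<^sup>2)"
  shows "integrable \<nu> f"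
proof -
  note [measurable_cong] = levy_measure_sets[OF \<nu>]
  have "integrable \<nu> (\<lambda>y. min 1 ((norm y)\<^sup>2))"
    using \<nu> by (intro integrableI_bounded) (measurable, auto simp: levy_measure_def)
  then have "integrable \<nu> (\<lambda>y. C * min 1 ((norm y)\<^sup>2))" by simp
  then show ?thesis
    by (rule Bochner_Integration.integrable_bound)
       (use f bnd in \<open>auto intro: order_trans[OF bnd abs_ge_self]\<close>)
qed

lemma levy_measure_one_minus_cos:
  assumes "levy_measure \<nu>"
  shows "integrable \<nu> (\<lambda>y. 1 - cos (x \<bullet> y))"
proof (rule levy_measure_integrable_bound[OF assms, where C = "2 + (norm x)\<^sup>2"])
  fix y
  have "1 - cos (x \<bullet> y) \<le> (norm x)\<^sup>2 * (norm y)\<^sup>2"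
  proof -
    have "(x \<bullet> y)\<^sup>2 \<le> (norm x * norm y)\<^sup>2"
      using Cauchy_Schwarz_ineq2[of x y] by (intro power2_le_iff_abs_le[THEN iffD2]) auto
    then show ?thesis using one_minus_cos_le[of "x \<bullet> y"] zero_le_power2[of "x \<bullet> y"]
      unfolding power_mult_distrib by linarith
  qed
  moreover have "1 - cos (x \<bullet> y) \<le> 2" using cos_ge_minus_one[of "x \<bullet> y"] by linarith
  ultimately show "norm (1 - cos (x \<bullet> y)) \<le> (2 + (norm x)\<^sup>2) * min 1 ((norm y)\<^sup>2)"
    by (auto simp: min_def algebra_simps) (smt (verit) zero_le_power2)+
qed measurable

text \<open>In the unit ball the compensator leaves a Taylor remainder of second order; outside it
  the integrand is bounded by 2. Integrability is what allows real parts to be taken under the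
  integral.\<close>

lemma levy_exponent_integrable:
  assumes "levy_measure \<nu>"
  shows "integrable \<nu> (\<lambda>y. iexp (x \<bullet> y) - 1 - \<i> * of_real (x \<bullet> y) * indicator (cball 0 1) y)"
proof (rule levy_measure_integrable_bound[OF assms, where C = "2 + (norm x)\<^sup>2"])
  fix y
  show "norm (iexp (x \<bullet> y) - 1 - \<i> * of_real (x \<bullet> y) * indicator (cball 0 1) y)
    \<le> (2 + (norm x)\<^sup>2) * min 1 ((norm y)\<^sup>2)"
  proof (cases "norm y \<le> 1")
    case True
    have "norm (iexp (x \<bullet> y) - 1 - \<i> * of_real (x \<bullet> y)) \<le> (x \<bullet> y)\<^sup>2 / 2"
      using iexp_approx1[of "x \<bullet> y" 1] by (simp add: numeral_2_eq_2 diff_diff_eq)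
    also have "\<dots> \<le> (norm x)\<^sup>2 * (norm y)\<^sup>2"
    proof -
      have "(x \<bullet> y)\<^sup>2 \<le> (norm x * norm y)\<^sup>2"
        using Cauchy_Schwarz_ineq2[of x y] by (intro power2_le_iff_abs_le[THEN iffD2]) auto
      moreover have "0 \<le> (x \<bullet> y)\<^sup>2" by simp
      ultimately show ?thesis unfolding power_mult_distrib by linarith
    qed
    also have "\<dots> \<le> (2 + (norm x)\<^sup>2) * min 1 ((norm y)\<^sup>2)"
      using True by (intro mult_mono) (auto simp: power_le_one)
    finally show ?thesis using True by simp
  next
    case False
    have "1 \<le> (norm y)\<^sup>2" using False by (intro one_le_power) auto
    then have "min 1 ((norm y)\<^sup>2) = 1" by simp
    moreover have "norm (iexp (x \<bullet> y) - 1) \<le> 2 + (norm x)\<^sup>2"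
      using norm_triangle_ineq4[of "iexp (x \<bullet> y)" 1] zero_le_power2[of "norm x"]
      unfolding norm_exp_i_times norm_one by linarith
    ultimately show ?thesis using False by simp
  qed
qed (measurable, simp)

text \<open>The compensator and the drift are imaginary, so the real part consists of the cosine
  integral and the Gaussian term, which is nonnegative and is dropped.\<close>

lemma integral_one_minus_cos_le_Re_levy_exponent:
  assumes \<nu>: "levy_measure \<nu>" and A: "0 \<le> x \<bullet> (A *v x)"
  shows "(LINT y|\<nu>. 1 - cos (x \<bullet> y)) \<le> Re (levy_exponent A \<gamma> \<nu> x)"
proof -
  let ?I = "\<lambda>y. iexp (x \<bullet> y) - 1 - \<i> * of_real (x \<bullet> y) * indicator (cball 0 1) y"
  have "Re (CLINT y|\<nu>. ?I y) = (LINT y|\<nu>. Re (?I y))"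
    by (rule integral_Re[symmetric]) (rule levy_exponent_integrable[OF \<nu>])
  also have "\<dots> = (LINT y|\<nu>. - (1 - cos (x \<bullet> y)))"
    by (intro Bochner_Integration.integral_cong) (auto simp: Re_exp indicator_def)
  also have "\<dots> = - (LINT y|\<nu>. 1 - cos (x \<bullet> y))" by (rule integral_minus)
  finally show ?thesis using A unfolding levy_exponent_def by simp
qed

text \<open>This is the derivative of exp (- h z) at h = 0, taken along h = 1 / (n + 1). The
  prefactor \<open>n\<close> counts the increments of the partition; replacing n + 1 by it costs a
  factor tending to 1.\<close>

lemma Re_exponential_rate:
  fixes z :: complex
  shows "(\<lambda>n. real n * (1 - Re (exp (- of_real (1 / real (Suc n)) * z)))) \<longlonglongrightarrow> Re z"
proof -
  have "((\<lambda>h. Re (exp (- of_real h * z))) has_field_derivative - Re z) (at 0)"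
  proof -
    have "((\<lambda>w. exp (- w * z)) has_field_derivative (- z)) (at (of_real 0))"
      by (auto intro!: derivative_eq_intros)
    then have "((\<lambda>h::real. exp (- of_real h * z)) has_vector_derivative (- z)) (at 0)"
      by (rule has_vector_derivative_real_field)
    then show ?thesis by (auto simp: has_vector_derivative_complex_iff)
  qed
  then have lim: "((\<lambda>h. (Re (exp (- of_real h * z)) - 1) / h) \<longlongrightarrow> - Re z) (at 0)"
    by (simp add: has_field_derivative_iff)
  have "filterlim (\<lambda>n. 1 / real (Suc n)) (at 0) sequentially"
    unfolding filterlim_at using LIMSEQ_inverse_real_of_nat by (auto simp: divide_inverse)
  from filterlim_compose[OF lim this]
  have "(\<lambda>n. - ((Re (exp (- of_real (1 / real (Suc n)) * z)) - 1) / (1 / real (Suc n)))) \<longlonglongrightarrow> Re z"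
    by (auto intro: tendsto_eq_intros)
  then have "(\<lambda>n. real (Suc n) * (1 - Re (exp (- of_real (1 / real (Suc n)) * z)))) \<longlonglongrightarrow> Re z"
    by (simp add: algebra_simps)
  from tendsto_mult[OF this LIMSEQ_n_over_Suc_n]
  have "(\<lambda>n. real (Suc n) * (1 - Re (exp (- of_real (1 / real (Suc n)) * z))) * (real n / real (Suc n))) \<longlonglongrightarrow> Re z"
    by (simp only: mult_1_right)
  moreover have "real (Suc n) * a * (real n / real (Suc n)) = real n * a" for a n
    by (simp del: of_nat_Suc)
  ultimately show ?thesis by (simp only:)
qed

section \<open>Integrability of the small jumps\<close>

text \<open>Two limits are taken, coordinate by coordinate. For fixed \<open>K\<close> the mesh
  tends to 0, which bounds a finite combination of values of the real part of the exponent by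
  \<open>4 * C\<close>, with \<open>C\<close> independent of \<open>K\<close>. Then \<open>K\<close>
  tends to infinity by monotone convergence.\<close>

lemma (in levy_process) finite_variation_jump_integrable:
  assumes fv: "finite_variation M X" and "has_levy_measure M X \<nu>"
  shows "(\<integral>\<^sup>+ y. ennreal (min 1 (norm y)) \<partial>\<nu>) < \<infinity>"
proof -
  obtain A \<gamma> where A: "\<And>x. 0 \<le> x \<bullet> (A *v x)" and \<nu>: "levy_measure \<nu>"
    and cf: "\<And>t \<xi>. t \<ge> 0 \<Longrightarrow> (CLINT \<omega>|M. iexp (X t \<omega> \<bullet> \<xi>)) = exp (- of_real t * levy_exponent A \<gamma> \<nu> \<xi>)"
    using assms(2) unfolding has_levy_measure_def has_levy_triplet_def by blast
  note [measurable_cong] = levy_measure_sets[OF \<nu>]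
  \<comment> \<open>The functions to be inserted are oscillations of one coordinate divided by 4:
    they are at most 1 and have the linear bound 5/4.\<close>
  obtain C where C: "\<And>f n. f \<in> borel_measurable borel \<Longrightarrow> (\<And>x. 0 \<le> f x) \<Longrightarrow> (\<And>x. f x \<le> 1) \<Longrightarrow>
    (\<And>x. f x \<le> (5/4) * norm x) \<Longrightarrow> real n * expectation (\<lambda>\<omega>. f (X (1 / real (Suc n)) \<omega>)) \<le> C"
    using finite_variation_bounded_rate[OF fv, of "5/4"] by (metis divide_nonneg_nonneg zero_le_numeral)
  have cball_m [measurable]: "cball (0::real^'d) 1 \<in> sets borel" by simp
  define c :: real where "c = (1 - cos 1) / 2"
  have c: "0 < c" using cos_monotone_0_pi[of 0 1] pi_gt_zero pi_ge_two by (simp add: c_def)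
  have osc_m [measurable]: "(\<lambda>y::real^'d. dyadic_oscillation K (y $ i)) \<in> borel_measurable borel" for K i
    by measurable
  \<comment> \<open>Frequency vectors along a basis direction make the oscillation of a coordinate
    accessible to the characteristic function.\<close>
  have osc_eq: "dyadic_oscillation K (y $ i) = (\<Sum>k<K. (1 - cos ((2 ^ k *\<^sub>R axis i 1) \<bullet> y)) / 2 ^ k)" for K i and y :: "real^'d"
    by (simp add: dyadic_oscillation_def inner_axis' )
  have bound: "integrable \<nu> (\<lambda>y. dyadic_oscillation K (y $ i))"
       "(LINT y|\<nu>. dyadic_oscillation K (y $ i)) \<le> 4 * C" for K i
  proof -
    let ?\<xi> = "\<lambda>k. 2 ^ k *\<^sub>R axis i 1 :: real^'d"
    let ?h = "\<lambda>n. 1 / real (Suc n)"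
    show "integrable \<nu> (\<lambda>y. dyadic_oscillation K (y $ i))"
      unfolding osc_eq by (intro Bochner_Integration.integrable_sum integrable_divide levy_measure_one_minus_cos \<nu>)
    have Xm [measurable]: "X s \<in> borel_measurable M" if "0 \<le> s" for s
      using random_variable_X[OF that] by simp
    have int: "integrable M (\<lambda>\<omega>. 1 - cos (\<xi> \<bullet> X (?h n) \<omega>))" for \<xi> n
      using Xm[of "?h n"] by (intro integrable_const_bound[of _ 2]) auto
    have "real n * expectation (\<lambda>\<omega>. 1 - cos (\<xi> \<bullet> X (?h n) \<omega>))
        = real n * (1 - Re (exp (- of_real (?h n) * levy_exponent A \<gamma> \<nu> \<xi>)))" for \<xi> n
    proof -
      have m: "X (?h n) \<in> borel_measurable M" by (rule Xm) simp
      have "Re (exp (- of_real (?h n) * levy_exponent A \<gamma> \<nu> \<xi>)) = Re (CLINT \<omega>|M. iexp (X (?h n) \<omega> \<bullet> \<xi>))"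
        using cf[of "?h n"] by simp
      also have "\<dots> = expectation (\<lambda>\<omega>. Re (iexp (X (?h n) \<omega> \<bullet> \<xi>)))"
        using m by (intro integral_Re[symmetric] integrable_const_bound[of _ 1]) auto
      also have "\<dots> = expectation (\<lambda>\<omega>. cos (\<xi> \<bullet> X (?h n) \<omega>))" by (simp add: Re_exp inner_commute)
      finally have e: "Re (exp (- of_real (?h n) * levy_exponent A \<gamma> \<nu> \<xi>)) = expectation (\<lambda>\<omega>. cos (\<xi> \<bullet> X (?h n) \<omega>))" .
      have "integrable M (\<lambda>\<omega>. cos (\<xi> \<bullet> X (?h n) \<omega>))"
        using m by (intro integrable_const_bound[of _ 1]) auto
      then show ?thesis unfolding e by (simp add: prob_space)
    qed
    then have lim: "(\<lambda>n. real n * expectation (\<lambda>\<omega>. 1 - cos (\<xi> \<bullet> X (?h n) \<omega>))) \<longlonglongrightarrow> Re (levy_exponent A \<gamma> \<nu> \<xi>)" for \<xi>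
      using Re_exponential_rate by (simp only:)
    have "(LINT y|\<nu>. dyadic_oscillation K (y $ i)) = (\<Sum>k<K. (LINT y|\<nu>. 1 - cos (?\<xi> k \<bullet> y)) / 2 ^ k)"
      unfolding osc_eq using levy_measure_one_minus_cos[OF \<nu>]
      by (subst Bochner_Integration.integral_sum) (auto simp del: inner_scaleR_left)
    also have "\<dots> \<le> (\<Sum>k<K. Re (levy_exponent A \<gamma> \<nu> (?\<xi> k)) / 2 ^ k)"
      by (intro sum_mono divide_right_mono integral_one_minus_cos_le_Re_levy_exponent \<nu> A) auto
    also have "\<dots> \<le> 4 * C"
    proof (rule LIMSEQ_le_const2)
      show "(\<lambda>n. \<Sum>k<K. real n * expectation (\<lambda>\<omega>. 1 - cos (?\<xi> k \<bullet> X (?h n) \<omega>)) / 2 ^ k)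
          \<longlonglongrightarrow> (\<Sum>k<K. Re (levy_exponent A \<gamma> \<nu> (?\<xi> k)) / 2 ^ k)"
        by (intro tendsto_intros lim) auto
      have "(\<Sum>k<K. real n * expectation (\<lambda>\<omega>. 1 - cos (?\<xi> k \<bullet> X (?h n) \<omega>)) / 2 ^ k) \<le> 4 * C" for n
      proof -
        have "(\<Sum>k<K. real n * expectation (\<lambda>\<omega>. 1 - cos (?\<xi> k \<bullet> X (?h n) \<omega>)) / 2 ^ k)
            = real n * expectation (\<lambda>\<omega>. dyadic_oscillation K (X (?h n) \<omega> $ i))"
          unfolding osc_eq using int
          by (subst Bochner_Integration.integral_sum) (auto simp: sum_distrib_left simp del: inner_scaleR_left)
        also have "\<dots> = 4 * (real n * expectation (\<lambda>\<omega>. dyadic_oscillation K (X (?h n) \<omega> $ i) / 4))"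
          by simp
        also have "\<dots> \<le> 4 * C"
        proof -
          have "dyadic_oscillation K (x $ i) / 4 \<le> 5 / 4 * norm x" for x :: "real^'d"
            using dyadic_oscillation_le_linear[of K "x $ i"] component_le_norm_cart[of x i] by linarith
          then show ?thesis
            using dyadic_oscillation_le_4 dyadic_oscillation_nonneg by (intro mult_left_mono C) auto
        qed
        finally show ?thesis .
      qed
      then show "\<exists>N. \<forall>n\<ge>N. (\<Sum>k<K. real n * expectation (\<lambda>\<omega>. 1 - cos (?\<xi> k \<bullet> X (?h n) \<omega>)) / 2 ^ k) \<le> 4 * C"
        by blast
    qed
    finally show "(LINT y|\<nu>. dyadic_oscillation K (y $ i)) \<le> 4 * C" .
  qed
  have coord: "(\<integral>\<^sup>+ y. ennreal (\<bar>y $ i\<bar> * indicator (cball 0 1) y) \<partial>\<nu>) < \<infinity>" for i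
  proof -
    \<comment> \<open>The index in the lower bound varies with \<open>y\<close>, so the supremum
      over \<open>K\<close> is formed before integrating.\<close>
    have "(\<integral>\<^sup>+ y. ennreal c * ennreal (\<bar>y $ i\<bar> * indicator (cball 0 1) y) \<partial>\<nu>)
        \<le> (\<integral>\<^sup>+ y. (SUP K. ennreal (dyadic_oscillation K (y $ i))) \<partial>\<nu>)"
    proof (rule nn_integral_mono)
      fix y :: "real^'d"
      show "ennreal c * ennreal (\<bar>y $ i\<bar> * indicator (cball 0 1) y) \<le> (SUP K. ennreal (dyadic_oscillation K (y $ i)))"
      proof (cases "norm y \<le> 1")
        case True
        then have "\<bar>y $ i\<bar> \<le> 1" using component_le_norm_cart[of y i] by linarith
        then obtain K where "c * \<bar>y $ i\<bar> \<le> dyadic_oscillation K (y $ i)"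
          using dyadic_oscillation_ge_linear unfolding c_def by blast
        then show ?thesis using True c
          by (intro SUP_upper2[of K]) (auto simp: ennreal_mult'[symmetric] intro!: ennreal_leI)
      qed simp
    qed
    also have "\<dots> = (SUP K. \<integral>\<^sup>+ y. ennreal (dyadic_oscillation K (y $ i)) \<partial>\<nu>)"
      by (intro nn_integral_monotone_convergence_SUP)
         (auto simp: incseq_def le_fun_def intro!: ennreal_leI dyadic_oscillation_mono)
    also have "\<dots> \<le> ennreal (4 * C)"
      using bound dyadic_oscillation_nonneg
      by (intro SUP_least) (subst nn_integral_eq_integral, auto intro!: ennreal_leI)
    finally have "ennreal c * (\<integral>\<^sup>+ y. ennreal (\<bar>y $ i\<bar> * indicator (cball 0 1) y) \<partial>\<nu>) < \<infinity>"
      by (subst (asm) nn_integral_cmult) (measurable, auto simp: le_less_trans)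
    then show ?thesis using c by (auto simp: ennreal_mult_less_top)
  qed
  \<comment> \<open>In the unit ball the norm is at most the sum of the absolute coordinates;
    outside it 1 \<le> |y|^2 and the Levy condition takes over.\<close>
  have "(\<integral>\<^sup>+ y. ennreal (min 1 (norm y)) \<partial>\<nu>)
      \<le> (\<integral>\<^sup>+ y. (\<Sum>i\<in>UNIV. ennreal (\<bar>y $ i\<bar> * indicator (cball 0 1) y)) + ennreal (min 1 ((norm y)\<^sup>2)) \<partial>\<nu>)"
  proof (rule nn_integral_mono)
    fix y :: "real^'d"
    show "ennreal (min 1 (norm y)) \<le> (\<Sum>i\<in>UNIV. ennreal (\<bar>y $ i\<bar> * indicator (cball 0 1) y)) + ennreal (min 1 ((norm y)\<^sup>2))"
    proof (cases "norm y \<le> 1")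
      case True
      then have "ennreal (min 1 (norm y)) \<le> (\<Sum>i\<in>UNIV. ennreal (\<bar>y $ i\<bar> * indicator (cball 0 1) y))"
        using norm_le_l1_cart[of y] by (subst sum_ennreal) (auto intro!: ennreal_leI)
      then show ?thesis by (simp add: add_increasing2)
    next
      case False
      then have "1 \<le> (norm y)\<^sup>2" by (intro one_le_power) auto
      then show ?thesis using False by (intro add_increasing) (auto intro!: ennreal_leI)
    qed
  qed
  also have "\<dots> < \<infinity>"
  proof -
    have "(\<integral>\<^sup>+ y. (\<Sum>i\<in>UNIV. ennreal (\<bar>y $ i\<bar> * indicator (cball 0 1) y)) \<partial>\<nu>) < \<infinity>"
    proof (subst nn_integral_sum)
      show "(\<lambda>y. ennreal (\<bar>y $ i\<bar> * indicator (cball 0 1) y)) \<in> borel_measurable \<nu>" for i by measurable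
    qed (use coord in \<open>auto simp: less_top[symmetric]\<close>)
    then show ?thesis
      using \<nu> by (subst nn_integral_add) (measurable, auto simp: levy_measure_def simp del: sum_ennreal)
  qed
  finally show ?thesis .
qed

section \<open>Continuously differentiable cut-off functions\<close>

text \<open>Squaring removes the kink of the positive part: at 0 the difference quotient is at most
  |h|. The cut-off below is built from two layers of this function.\<close>

lemma pos_part_square_derivative:
  "((\<lambda>t::real. (max 0 t)\<^sup>2) has_field_derivative 2 * max 0 t) (at t)"
proof -
  consider "t < 0" | "t = 0" | "0 < t" by linarith
  then show ?thesis
  proof cases
    case 1
    have "((\<lambda>t::real. 0) has_field_derivative 2 * max 0 t) (at t)" using 1 by simp
    then show ?thesis
      by (rule has_field_derivative_transform_within_open[of _ _ _ "{..<0}"]) (use 1 in auto)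
  next
    case 2
    have "((\<lambda>h::real. (max 0 h)\<^sup>2 / h) \<longlongrightarrow> 0) (at 0)"
    proof (rule Lim_null_comparison)
      show "\<forall>\<^sub>F h::real in at 0. norm ((max 0 h)\<^sup>2 / h) \<le> \<bar>h\<bar>"
        by (intro always_eventually) (auto simp: max_def power2_eq_square)
      show "((\<lambda>h::real. \<bar>h\<bar>) \<longlongrightarrow> 0) (at 0)" by (intro tendsto_rabs_zero tendsto_ident_at)
    qed
    then show ?thesis using 2 by (simp add: has_field_derivative_iff)
  next
    case 3
    have "((\<lambda>t::real. t\<^sup>2) has_field_derivative 2 * max 0 t) (at t)"
      using 3 by (auto intro!: derivative_eq_intros)
    then show ?thesis
      by (rule has_field_derivative_transform_within_open[of _ _ _ "{0<..}"]) (use 3 in auto)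
  qed
qed

text \<open>Finitely many balls cover \<open>K\<close>, their closures lying in \<open>U\<close>.
  The sum \<open>w\<close> of squared positive parts, one for each ball, is C1, vanishes off the
  closed balls and is at least some \<delta> > 0 on \<open>K\<close>. Then \<open>u\<close> flattens
  \<open>w\<close> by another squared positive part: it is 1 where w \<ge> \<delta> and 0 where w =
  0.\<close>

lemma C1_bump:
  fixes K U :: "'a::euclidean_space set"
  assumes "compact K" "open U" "K \<subseteq> U"
  obtains u G where "\<And>x. (u has_derivative (\<lambda>h. G x \<bullet> h)) (at x)"
    "continuous_on UNIV G" "bounded (range G)" "bounded {x. u x \<noteq> 0}" "{x. u x \<noteq> 0} \<subseteq> U"
    "\<And>x. 0 \<le> u x" "\<And>x. u x \<le> (1::real)" "\<And>x. x \<in> K \<Longrightarrow> u x = 1"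
proof -
  have "\<exists>r>0. cball x r \<subseteq> U" if "x \<in> K" for x
    using that assms open_contains_cball by blast
  then obtain r where r: "\<And>x. x \<in> K \<Longrightarrow> 0 < r x" "\<And>x. x \<in> K \<Longrightarrow> cball x (r x) \<subseteq> U" by metis
  have "K \<subseteq> (\<Union>x\<in>K. ball x (r x))" using r by force
  then obtain C where C: "C \<subseteq> K" "finite C" "K \<subseteq> (\<Union>c\<in>C. ball c (r c))"
    using compactE_image[OF \<open>compact K\<close>, of K "\<lambda>x. ball x (r x)"] by blast
  define T where "T = (\<Union>c\<in>C. cball c (r c))"
  have "compact T" unfolding T_def using C(2) by (intro compact_UN) auto
  moreover have "T \<subseteq> U" unfolding T_def using C(1) r(2) by (intro UN_least) blast
  ultimately have T: "compact T" "T \<subseteq> U" by auto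
  define q where "q c x = max 0 ((r c)\<^sup>2 - (x - c) \<bullet> (x - c))" for c x
  define w where "w x = (\<Sum>c\<in>C. (q c x)\<^sup>2)" for x
  \<comment> \<open>The gradient of \<open>w\<close>; likewise \<open>G\<close> below is that of
    \<open>u\<close>.\<close>
  define W where "W x = (\<Sum>c\<in>C. (- 4 * q c x) *\<^sub>R (x - c))" for x
  have q0: "q c x = 0" if "x \<notin> cball c (r c)" "c \<in> C" for c x
  proof -
    have "0 < r c" using C r that by auto
    then have "(r c)\<^sup>2 \<le> (norm (x - c))\<^sup>2"
      using that by (intro power_mono) (auto simp: dist_norm norm_minus_commute)
    then show ?thesis by (simp add: q_def power2_norm_eq_inner)
  qed
  have q_pos: "0 < q c x" if "x \<in> ball c (r c)" for c x
  proof -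
    have "(norm (x - c))\<^sup>2 < (r c)\<^sup>2"
      using that by (intro power_strict_mono) (auto simp: dist_norm norm_minus_commute)
    then show ?thesis by (simp add: q_def power2_norm_eq_inner)
  qed
  have cont_q: "continuous_on S (q c)" for S c unfolding q_def by (intro continuous_intros)
  have cont_w: "continuous_on S w" for S unfolding w_def by (intro continuous_intros cont_q)
  have cont_W: "continuous_on S W" for S unfolding W_def by (intro continuous_intros cont_q)
  have dw: "(w has_derivative (\<lambda>h. W x \<bullet> h)) (at x)" for x
  proof -
    have "((\<lambda>x. (q c x)\<^sup>2) has_derivative (\<lambda>h. ((- 4 * q c x) *\<^sub>R (x - c)) \<bullet> h)) (at x)" for c
    proof -
      have 1: "((\<lambda>x. (r c)\<^sup>2 - (x - c) \<bullet> (x - c)) has_derivative (\<lambda>h. - (2 * ((x - c) \<bullet> h)))) (at x)"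
        by (auto intro!: derivative_eq_intros simp: inner_commute)
      show ?thesis
        using has_derivative_compose[OF 1 pos_part_square_derivative[THEN has_field_derivative_imp_has_derivative]]
        by (simp add: q_def mult_ac)
    qed
    then show ?thesis unfolding w_def W_def inner_sum_left by (intro has_derivative_sum)
  qed
  have w_nonneg: "0 \<le> w x" for x unfolding w_def by (intro sum_nonneg) auto
  obtain \<delta> where \<delta>: "0 < \<delta>" "\<And>x. x \<in> K \<Longrightarrow> \<delta> \<le> w x"
  proof (cases "K = {}")
    case False
    then obtain x0 where x0: "x0 \<in> K" "\<And>x. x \<in> K \<Longrightarrow> w x0 \<le> w x"
      using continuous_attains_inf[OF \<open>compact K\<close> _ cont_w] by blast
    obtain c where c: "c \<in> C" "x0 \<in> ball c (r c)" using x0 C by blast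
    have "0 < w x0" unfolding w_def by (rule sum_pos2[OF \<open>finite C\<close> c(1)]) (use q_pos[OF c(2)] in auto)
    then show ?thesis using x0 that by blast
  qed (use that[of 1] in auto)
  define p where "p x = max 0 (1 - w x / \<delta>)" for x
  define u where "u x = 1 - (p x)\<^sup>2" for x
  define G where "G x = (2 * p x / \<delta>) *\<^sub>R W x" for x
  have cont_p: "continuous_on S p" for S unfolding p_def using \<delta>(1) by (intro continuous_intros cont_w) auto
  have p: "0 \<le> p x" "p x \<le> 1" for x
    using divide_nonneg_pos[OF w_nonneg[of x] \<delta>(1)] by (simp_all add: p_def)
  have cont_G: "continuous_on UNIV G" unfolding G_def using \<delta>(1) by (intro continuous_intros cont_p cont_W) auto
  have supp: "{x. u x \<noteq> 0} \<subseteq> T"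
  proof
    fix x assume "x \<in> {x. u x \<noteq> 0}"
    then have "w x \<noteq> 0" by (auto simp: u_def p_def)
    then obtain c where "c \<in> C" "(q c x)\<^sup>2 \<noteq> 0" unfolding w_def by (rule sum.not_neutral_contains_not_neutral)
    then show "x \<in> T" using q0[of x c] unfolding T_def by auto
  qed
  show ?thesis
  proof (rule that[of u G])
    show "(u has_derivative (\<lambda>h. G x \<bullet> h)) (at x)" for x
    proof -
      have 1: "((\<lambda>x. 1 - w x / \<delta>) has_derivative (\<lambda>h. - (W x \<bullet> h / \<delta>))) (at x)"
        using \<delta>(1) by (auto intro!: derivative_eq_intros dw)
      have "((\<lambda>x. (p x)\<^sup>2) has_derivative (\<lambda>h. 2 * p x * - (W x \<bullet> h / \<delta>))) (at x)"
        using has_derivative_compose[OF 1 pos_part_square_derivative[THEN has_field_derivative_imp_has_derivative]]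
        by (simp add: p_def)
      from has_derivative_diff[OF has_derivative_const this, of 1] show ?thesis
        unfolding u_def G_def by simp
    qed
    show "continuous_on UNIV G" by (rule cont_G)
    \<comment> \<open>The gradient vanishes off the compact set \<open>T\<close>, so its continuity
      bounds it everywhere.\<close>
    have "W x = 0" if "x \<notin> T" for x
      unfolding W_def using that q0 by (intro sum.neutral) (auto simp: T_def)
    then have "G x = 0" if "x \<notin> T" for x using that by (simp add: G_def)
    then have "range G \<subseteq> insert 0 (G ` T)" by blast
    moreover have "compact (G ` T)"
      by (rule compact_continuous_image[OF continuous_on_subset[OF cont_G]]) (use T in auto)
    ultimately show "bounded (range G)" by (meson bounded_insert bounded_subset compact_imp_bounded)
    show "bounded {x. u x \<noteq> 0}" using supp T bounded_subset compact_imp_bounded by blast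
    show "{x. u x \<noteq> 0} \<subseteq> U" using supp T by blast
    show "0 \<le> u x" "u x \<le> 1" for x using p[of x] by (auto simp: u_def power_le_one)
    show "u x = 1" if "x \<in> K" for x using \<delta>(1) \<delta>(2)[OF that] by (simp add: u_def p_def)
  qed
qed

section \<open>Translated test functions and the perimeter\<close>

text \<open>A scalar function times a constant vector \<open>e\<close> has a Jacobian of rank one,
  whose trace is the derivative in direction \<open>e\<close>. This is how directional derivatives
  enter the perimeter.\<close>

lemma translated_test_field:
  fixes u :: "real ^ 'd \<Rightarrow> real" and e z :: "real ^ 'd"
  assumes du: "\<And>x. (u has_derivative (\<lambda>h. G x \<bullet> h)) (at x)" and contG: "continuous_on UNIV G"
    and bnd: "bounded {x. u x \<noteq> 0}"
  shows "C1_compact_support (\<lambda>x. u (x + z) *\<^sub>R e)"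
    and "divergence (\<lambda>x. u (x + z) *\<^sub>R e) x = G (x + z) \<bullet> e"
proof -
  let ?\<phi> = "\<lambda>x. u (x + z) *\<^sub>R e"
  have d: "(?\<phi> has_derivative (\<lambda>h. (G (x + z) \<bullet> h) *\<^sub>R e)) (at x)" for x
  proof -
    have 1: "((\<lambda>x. x + z) has_derivative (\<lambda>h. h)) (at x)" by (auto intro!: derivative_eq_intros)
    show ?thesis using has_derivative_compose[OF 1 du] by (auto intro!: derivative_eq_intros)
  qed
  have j: "jacobian ?\<phi> (at x) = (\<chi> i j. (G (x + z) $ j) * e $ i)" for x
    unfolding jacobian_def frechet_derivative_at[OF d, symmetric] matrix_def
    by (simp add: inner_axis)
  have "bounded {x. ?\<phi> x \<noteq> 0}"
  proof (rule bounded_subset[OF bounded_translation[OF bnd, of "- z"]])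
    show "{x. ?\<phi> x \<noteq> 0} \<subseteq> (+) (- z) ` {x. u x \<noteq> 0}"
    proof
      fix x assume "x \<in> {x. ?\<phi> x \<noteq> 0}"
      then show "x \<in> (+) (- z) ` {x. u x \<noteq> 0}" by (intro image_eqI[of _ _ "x + z"]) auto
    qed
  qed
  moreover have "continuous_on UNIV (\<lambda>x. jacobian ?\<phi> (at x))"
    unfolding j by (intro continuous_on_vec_lambda continuous_intros continuous_on_compose2[OF contG]) auto
  moreover have "?\<phi> differentiable_on UNIV"
    using d by (auto simp: differentiable_on_def differentiable_def)
  ultimately show "C1_compact_support ?\<phi>" by (simp add: C1_compact_support_def)
  show "divergence ?\<phi> x = G (x + z) \<bullet> e"
    by (simp add: divergence_def j trace_def inner_vec_def)
qed

text \<open>Differentiation under the integral by dominated convergence: a bounded gradient makes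
  \<open>u\<close> Lipschitz, so the difference quotients are at most \<open>L * norm z\<close> on
  \<open>B\<close>, a set of finite measure.\<close>

lemma integral_translate_derivative:
  fixes u :: "'a::euclidean_space \<Rightarrow> real" and z :: 'a
  assumes B [measurable]: "B \<in> sets borel" and fin: "emeasure lborel B < \<infinity>"
    and du: "\<And>x. (u has_derivative (\<lambda>h. G x \<bullet> h)) (at x)" and contG: "continuous_on UNIV G"
    and bG: "bounded (range G)" and ub: "\<And>x. \<bar>u x\<bar> \<le> 1"
  shows "((\<lambda>s. LINT x|lborel. indicator B x * u (x + s *\<^sub>R z)) has_field_derivative
    (LINT x|lborel. indicator B x * (G (x + s *\<^sub>R z) \<bullet> z))) (at s)"
proof -
  obtain L where L: "\<And>x. norm (G x) \<le> L" using bG by (auto simp: bounded_iff)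
  have Gm [measurable]: "G \<in> borel_measurable borel"
    by (rule borel_measurable_continuous_onI[OF contG])
  have "continuous_on UNIV u"
    using du by (meson continuous_at_imp_continuous_on has_derivative_continuous)
  then have um [measurable]: "u \<in> borel_measurable borel"
    by (rule borel_measurable_continuous_onI)
  have lip: "\<bar>u a - u b\<bar> \<le> L * norm (a - b)" for a b
  proof -
    have "onorm (\<lambda>h. G x \<bullet> h) \<le> L" for x
    proof (rule onorm_le)
      fix h
      have "norm (G x \<bullet> h) \<le> norm (G x) * norm h" using Cauchy_Schwarz_ineq2[of "G x" h] by simp
      also have "\<dots> \<le> L * norm h" by (intro mult_right_mono L) auto
      finally show "norm (G x \<bullet> h) \<le> L * norm h" .
    qed
    then show ?thesis using differentiable_bound[of UNIV u "\<lambda>x h. G x \<bullet> h" L a b] du by simp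
  qed
  have int: "integrable lborel (\<lambda>x. indicator B x * u (x + t *\<^sub>R z))" for t
    by (rule integrableI_bounded_set[of B _ _ 1]) (use fin ub in \<open>auto simp: indicator_def\<close>)
  show ?thesis
    unfolding DERIV_def tendsto_at_iff_sequentially comp_def
  proof (intro allI impI)
    fix H :: "nat \<Rightarrow> real" assume H: "\<forall>i. H i \<in> UNIV - {0}" "H \<longlonglongrightarrow> 0"
    have "((\<lambda>h. (u (x + (s + h) *\<^sub>R z) - u (x + s *\<^sub>R z)) / h) \<longlongrightarrow> G (x + s *\<^sub>R z) \<bullet> z) (at 0)" for x
    proof -
      have "((\<lambda>t. x + t *\<^sub>R z) has_derivative (\<lambda>h. h *\<^sub>R z)) (at s)"
        by (auto intro!: derivative_eq_intros)
      from has_derivative_compose[OF this du]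
      have "((\<lambda>t. u (x + t *\<^sub>R z)) has_field_derivative G (x + s *\<^sub>R z) \<bullet> z) (at s)"
        by (simp add: has_field_derivative_def mult.commute[of _ "_ \<bullet> _"])
      then show ?thesis by (simp add: DERIV_def)
    qed
    then have lim: "(\<lambda>n. (u (x + (s + H n) *\<^sub>R z) - u (x + s *\<^sub>R z)) / H n) \<longlonglongrightarrow> G (x + s *\<^sub>R z) \<bullet> z" for x
      using H unfolding tendsto_at_iff_sequentially comp_def by blast
    have "(\<lambda>n. LINT x|lborel. indicator B x * ((u (x + (s + H n) *\<^sub>R z) - u (x + s *\<^sub>R z)) / H n))
        \<longlonglongrightarrow> (LINT x|lborel. indicator B x * (G (x + s *\<^sub>R z) \<bullet> z))"
    proof (rule integral_dominated_convergence[where w = "\<lambda>x. indicator B x * (L * norm z)"])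
      show "integrable lborel (\<lambda>x. indicator B x * (L * norm z))"
        using fin by (intro integrable_mult_left integrable_real_indicator) auto
      show "AE x in lborel. (\<lambda>n. indicator B x * ((u (x + (s + H n) *\<^sub>R z) - u (x + s *\<^sub>R z)) / H n))
          \<longlonglongrightarrow> indicator B x * (G (x + s *\<^sub>R z) \<bullet> z)"
        by (intro AE_I2 tendsto_intros lim)
      show "AE x in lborel. norm (indicator B x * ((u (x + (s + H n) *\<^sub>R z) - u (x + s *\<^sub>R z)) / H n))
          \<le> indicator B x * (L * norm z)" for n
      proof (rule AE_I2)
        fix x
        have "\<bar>u (x + (s + H n) *\<^sub>R z) - u (x + s *\<^sub>R z)\<bar> \<le> L * norm (H n *\<^sub>R z)"
          using lip[of "x + (s + H n) *\<^sub>R z" "x + s *\<^sub>R z"] by (simp add: algebra_simps)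
        then have "\<bar>(u (x + (s + H n) *\<^sub>R z) - u (x + s *\<^sub>R z)) / H n\<bar> \<le> L * norm z"
          using H(1)[rule_format, of n] by (simp add: field_simps)
        then show "norm (indicator B x * ((u (x + (s + H n) *\<^sub>R z) - u (x + s *\<^sub>R z)) / H n)) \<le> indicator B x * (L * norm z)"
          by (simp add: indicator_def)
      qed
    qed measurable
    moreover have "(LINT x|lborel. indicator B x * ((u (x + (s + H n) *\<^sub>R z) - u (x + s *\<^sub>R z)) / H n))
       = ((LINT x|lborel. indicator B x * u (x + (s + H n) *\<^sub>R z)) - (LINT x|lborel. indicator B x * u (x + s *\<^sub>R z))) / H n" for n
    proof -
      have "(LINT x|lborel. indicator B x * ((u (x + (s + H n) *\<^sub>R z) - u (x + s *\<^sub>R z)) / H n))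
          = (LINT x|lborel. (indicator B x * u (x + (s + H n) *\<^sub>R z) - indicator B x * u (x + s *\<^sub>R z)) / H n)"
        by (simp add: right_diff_distrib)
      then show ?thesis
        by (simp only: integral_divide_zero Bochner_Integration.integral_diff[OF int int])
    qed
    ultimately show "(\<lambda>n. ((LINT x|lborel. indicator B x * u (x + (s + H n) *\<^sub>R z)) -
              (LINT x|lborel. indicator B x * u (x + s *\<^sub>R z))) / H n)
         \<longlonglongrightarrow> (LINT x|lborel. indicator B x * (G (x + s *\<^sub>R z) \<bullet> z))" by (simp only:)
  qed
qed

text \<open>The mean value theorem in the translation parameter expresses the difference by the
  derivative at a single \<open>s\<close>. That derivative is, up to the factor |z|, the integral
  over \<open>B\<close> of the divergence of one admissible field.\<close>

lemma integral_translate_le_perimeter: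
  fixes u :: "real ^ 'd \<Rightarrow> real" and z :: "real ^ 'd"
  assumes B [measurable]: "B \<in> sets borel" and fin: "emeasure lborel B < \<infinity>"
    and per: "perimeter B \<le> ereal P"
    and du: "\<And>x. (u has_derivative (\<lambda>h. G x \<bullet> h)) (at x)" and contG: "continuous_on UNIV G"
    and bG: "bounded (range G)" and bu: "bounded {x. u x \<noteq> 0}" and ub: "\<And>x. \<bar>u x\<bar> \<le> 1"
  shows "(LINT x|lborel. indicator B x * u x) - (LINT x|lborel. indicator B x * u (x + z)) \<le> norm z * P"
proof -
  have Gm [measurable]: "G \<in> borel_measurable borel"
    by (rule borel_measurable_continuous_onI[OF contG])
  define F where "F s = (LINT x|lborel. indicator B x * u (x + s *\<^sub>R z))" for s
  obtain s where s: "F 1 - F 0 = (LINT x|lborel. indicator B x * (G (x + s *\<^sub>R z) \<bullet> z))"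
    using MVT2[of 0 1 F "\<lambda>s. LINT x|lborel. indicator B x * (G (x + s *\<^sub>R z) \<bullet> z)"]
      integral_translate_derivative[OF B fin du contG bG ub, of z] unfolding F_def by auto
  \<comment> \<open>The minus sign yields \<open>F 0 - F 1\<close>. For z = 0 the value
    \<open>sgn 0 = 0\<close> gives the zero field, which is still admissible.\<close>
  define \<phi> where "\<phi> x = u (x + s *\<^sub>R z) *\<^sub>R (- sgn z)" for x
  have "C1_compact_support \<phi>" and div: "divergence \<phi> x = G (x + s *\<^sub>R z) \<bullet> (- sgn z)" for x
    unfolding \<phi>_def by (rule translated_test_field[OF du contG bu])+
  moreover have "norm (\<phi> x) \<le> 1" for x
    using ub[of "x + s *\<^sub>R z"] by (simp add: \<phi>_def norm_sgn)
  ultimately have "ereal (LINT x|lebesgue. indicator B x * divergence \<phi> x) \<le> perimeter B"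
    unfolding perimeter_def by (intro SUP_upper[where i = \<phi>]) simp
  then have "ereal (LINT x|lebesgue. indicator B x * divergence \<phi> x) \<le> ereal P"
    using per by (rule order_trans)
  moreover have "(LINT x|lebesgue. indicator B x * divergence \<phi> x)
      = (LINT x|lborel. indicator B x * (G (x + s *\<^sub>R z) \<bullet> (- sgn z)))"
    unfolding div by (rule integral_completion) measurable
  ultimately have le: "norm z * (LINT x|lborel. indicator B x * (G (x + s *\<^sub>R z) \<bullet> (- sgn z))) \<le> norm z * P"
    by (intro mult_left_mono) auto
  have "norm z * (LINT x|lborel. indicator B x * (G (x + s *\<^sub>R z) \<bullet> (- sgn z)))
      = (LINT x|lborel. norm z * (indicator B x * (G (x + s *\<^sub>R z) \<bullet> (- sgn z))))"
    by (rule integral_mult_right_zero[symmetric])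
  also have "\<dots> = (LINT x|lborel. - (indicator B x * (G (x + s *\<^sub>R z) \<bullet> z)))"
    proof (rule Bochner_Integration.integral_cong)
    show "norm z * (indicator B x * (G (x + s *\<^sub>R z) \<bullet> (- sgn z))) = - (indicator B x * (G (x + s *\<^sub>R z) \<bullet> z))" for x
      by (cases "z = 0") (auto simp: sgn_div_norm)
  qed simp
  also have "\<dots> = F 0 - F 1" unfolding integral_minus s[symmetric] by simp
  finally show ?thesis using le by (simp add: F_def)
qed

section \<open>Measure of the points that a translation moves out of a set\<close>

lemma integral_lborel_translate:
  fixes f :: "'a::euclidean_space \<Rightarrow> 'b::{banach, second_countable_topology}"
  assumes [measurable]: "f \<in> borel_measurable borel"
  shows "(LINT x|lborel. f (c + x)) = (LINT x|lborel. f x)"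
proof -
  have "(LINT x|lborel. f x) = (LINT x|distr lborel borel ((+) c). f x)" by (simp add: lborel_distr_plus)
  also have "\<dots> = (LINT x|lborel. f (c + x))" by (rule integral_distr) auto
  finally show ?thesis by simp
qed

text \<open>Inner regularity of a finite Borel measure, applied to Lebesgue measure restricted to
  \<open>E\<close>.\<close>

lemma inner_regular_lborel:
  fixes E :: "'a::euclidean_space set"
  assumes [measurable]: "E \<in> sets borel" and fin: "emeasure lborel E < \<infinity>" and "0 < \<epsilon>"
  obtains K where "compact K" "K \<subseteq> E" "measure lborel E < measure lborel K + \<epsilon>"
\<comment> \<open>A set this small is approximated by the empty set. Otherwise the difference with
  \<epsilon> is nonnegative and \<open>ennreal\<close> does not truncate it.\<close>
proof (cases "measure lborel E < \<epsilon>")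
  case True
  then show ?thesis using that[of "{}"] by simp
next
  case False
  let ?N = "density lborel (indicator E)"
  have N: "emeasure ?N X = emeasure lborel (E \<inter> X)" if "X \<in> sets borel" for X
    using that by (intro emeasure_restricted) auto
  have E: "emeasure lborel E = ennreal (measure lborel E)"
    using fin by (intro emeasure_eq_ennreal_measure) auto
  have "emeasure ?N E = (SUP K \<in> {K. K \<subseteq> E \<and> compact K}. emeasure ?N K)"
    by (rule inner_regular) (use fin N[of UNIV] in auto)
  moreover have "ennreal (measure lborel E - \<epsilon>) < emeasure ?N E"
    using False \<open>0 < \<epsilon>\<close> by (simp add: N E ennreal_less_iff)
  ultimately obtain K where K: "K \<subseteq> E" "compact K" "ennreal (measure lborel E - \<epsilon>) < emeasure ?N K"
    by (auto simp: less_SUP_iff)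
  have "emeasure ?N K = emeasure lborel K" using K N[of K] by (simp add: Int_absorb1 compact_imp_closed)
  also have "\<dots> = ennreal (measure lborel K)"
    using emeasure_mono[of K E lborel] K fin by (intro emeasure_eq_ennreal_measure) auto
  finally have "measure lborel E - \<epsilon> < measure lborel K"
    using K False by (simp add: ennreal_less_iff)
  then show ?thesis using that K by auto
qed

text \<open>
  If \<open>u\<close> is \<open>1\<close> on a compact part \<open>K\<close> of the exit set and vanishes outside a small neighbourhood
  \<open>U\<close> of \<open>K\<close>, then \<open>(1\<^sub>B(x) - 1\<^sub>B(x + y)) u(x)\<close> is at least \<open>1\<^sub>K(x) - 1\<^sub>U\<^sub>-\<^sub>K(x)\<close>.
\<close>

lemma emeasure_exit_le_perimeter:
  fixes B :: "(real ^ 'd) set"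
  assumes B [measurable]: "B \<in> sets borel" and fin: "emeasure lborel B < \<infinity>"
    and per: "perimeter B \<le> ereal P"
  shows "emeasure lborel {x \<in> B. x + y \<notin> B} \<le> ennreal (norm y * P)"
proof -
  define E where "E = {x \<in> B. x + y \<notin> B}"
  have E [measurable]: "E \<in> sets borel" unfolding E_def by measurable
  have finE: "emeasure lborel E < \<infinity>"
    using fin by (rule le_less_trans[rotated]) (auto simp: E_def intro!: emeasure_mono)
  have "measure lborel E \<le> norm y * P"
  proof (rule field_le_epsilon)
    fix \<epsilon> :: real assume "0 < \<epsilon>"
    \<comment> \<open>One half of \<epsilon> is spent on \<open>E - K\<close>, the other on
      \<open>U - K\<close>.\<close>
    obtain K where K: "compact K" "K \<subseteq> E" "measure lborel E < measure lborel K + \<epsilon> / 2"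
      using inner_regular_lborel[OF E finE, of "\<epsilon> / 2"] \<open>0 < \<epsilon>\<close> by auto
    have Km [measurable]: "K \<in> sets borel" using K by (simp add: compact_imp_closed)
    obtain U where U: "open U" "K \<subseteq> U" "emeasure lborel (U - K) < ennreal (\<epsilon> / 2)"
      by (rule outer_regular_lborel[OF Km, where e = "\<epsilon> / 2"]) (use \<open>0 < \<epsilon>\<close> in simp)
    have Um [measurable]: "U \<in> sets borel" using U by simp
    obtain u G where u: "\<And>x. (u has_derivative (\<lambda>h. G x \<bullet> h)) (at x)"
      "continuous_on UNIV G" "bounded (range G)" "bounded {x. u x \<noteq> 0}" "{x. u x \<noteq> 0} \<subseteq> U"
      "\<And>x. 0 \<le> u x" "\<And>x. u x \<le> (1::real)" "\<And>x. x \<in> K \<Longrightarrow> u x = 1"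
      using C1_bump[OF K(1) U(1,2)] by blast
    have "continuous_on UNIV u"
      using u(1) by (meson continuous_at_imp_continuous_on has_derivative_continuous)
    then have um [measurable]: "u \<in> borel_measurable borel"
      by (rule borel_measurable_continuous_onI)
    have UK: "measure lborel (U - K) \<le> \<epsilon> / 2"
      using U(3) \<open>0 < \<epsilon>\<close> unfolding measure_def by (intro enn2real_leI) auto
    have intK: "integrable lborel (indicator K :: _ \<Rightarrow> real)"
      using emeasure_mono[OF K(2), of lborel] finE by (intro integrable_real_indicator) auto
    have intUK: "integrable lborel (indicator (U - K) :: _ \<Rightarrow> real)"
      using U(3) by (intro integrable_real_indicator) (auto simp: less_trans[OF _ ennreal_less_top])
    have int1: "integrable lborel (\<lambda>x. indicator B x * u x)"
      by (rule integrableI_bounded_set[of B _ _ 1]) (use fin u in \<open>auto simp: indicator_def\<close>)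
    have fin': "emeasure lborel ((+) y -` B) < \<infinity>"
    proof -
      have "emeasure lborel B = emeasure (distr lborel borel ((+) y)) B" by (simp add: lborel_distr_plus)
      also have "\<dots> = emeasure lborel ((+) y -` B)" by (subst emeasure_distr) auto
      finally show ?thesis using fin by simp
    qed
    have m': "(+) y -` B \<in> sets borel"
      using measurable_sets[of "(+) y" borel borel B] by simp
    have int2: "integrable lborel (\<lambda>x. indicator B (y + x) * u x)"
      by (rule integrableI_bounded_set[of "(+) y -` B" _ _ 1])
         (use fin' m' u in \<open>auto simp: indicator_def\<close>)
    have 1: "measure lborel K - measure lborel (U - K) = (LINT x|lborel. indicator K x - indicator (U - K) x)"
      by (simp only: Bochner_Integration.integral_diff[OF intK intUK] Bochner_Integration.integral_indicator space_lborel space_borel Int_UNIV_right)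
    have 2: "(LINT x|lborel. indicator K x - indicator (U - K) x)
        \<le> (LINT x|lborel. indicator B x * u x - indicator B (y + x) * u x)"
    proof (rule integral_mono)
      fix x
      show "indicator K x - indicator (U - K) x \<le> indicator B x * u x - indicator B (y + x) * u x"
      proof (cases "x \<in> K")
        case True
        then have "x \<in> B" "y + x \<notin> B" using K(2) by (auto simp: E_def add.commute)
        then show ?thesis using True u(8) by simp
      next
        case False
        note xK = False
        show ?thesis
        proof (cases "x \<in> U")
          case True
          then show ?thesis using xK u(6,7)[of x] by (simp add: indicator_def)
        next
          case False
          then have "u x = 0" using u(5) by blast
          then show ?thesis using False xK by simp
        qed
      qed
    qed (rule Bochner_Integration.integrable_diff; fact)+
    \<comment> \<open>Translation invariance moves the shift from \<open>B\<close> to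
      \<open>u\<close>, where the perimeter bound applies with z = - y.\<close>
    have 3: "(LINT x|lborel. indicator B (y + x) * u x) = (LINT x|lborel. indicator B x * u (x + (- y)))"
      using integral_lborel_translate[where f = "\<lambda>x. indicator B x * u (x + (- y))" and c = y] by simp
    have 4: "(LINT x|lborel. indicator B x * u x) - (LINT x|lborel. indicator B x * u (x + (- y))) \<le> norm (- y) * P"
      by (rule integral_translate_le_perimeter[OF B fin per u(1-4)]) (use u(6,7) in \<open>simp add: abs_le_iff order_trans[of _ 0]\<close>)
    show "measure lborel E \<le> norm y * P + \<epsilon>"
      using 1 2 4 UK K(3) unfolding Bochner_Integration.integral_diff[OF int1 int2] 3 norm_minus_cancel by linarith
  qed
  then have "ennreal (measure lborel E) \<le> ennreal (norm y * P)" by (rule ennreal_leI)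
  then show ?thesis using finE by (simp add: emeasure_eq_ennreal_measure E_def)
qed

section \<open>Sigma-finiteness, Borel representatives and Tonelli's theorem\<close>

text \<open>Needed for Tonelli. By Markov's inequality the complements of balls around 0 have finite
  measure; the origin, which they miss, is a null set.\<close>

lemma levy_measure_sigma_finite:
  assumes \<nu>: "levy_measure (\<nu> :: (real ^ 'd) measure)"
  shows "sigma_finite_measure \<nu>"
proof
  note [measurable_cong] = levy_measure_sets[OF \<nu>]
  have sp: "space \<nu> = UNIV" using sets_eq_imp_space_eq[OF levy_measure_sets[OF \<nu>]] by simp
  define T where "T n = {y :: real ^ 'd. 1 / real (Suc n) \<le> norm y}" for n
  have "closed (T n)" for n unfolding T_def by (intro closed_Collect_le continuous_intros)
  then have Tm [measurable]: "T n \<in> sets borel" for n by simp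
  have fin: "emeasure \<nu> (T n) < \<infinity>" for n
  proof -
    define c :: real where "c = (1 / real (Suc n))\<^sup>2"
    have c: "0 < c" "c \<le> 1" by (auto simp: c_def power_le_one)
    have "ennreal c * emeasure \<nu> (T n) = (\<integral>\<^sup>+ y. ennreal c * indicator (T n) y \<partial>\<nu>)"
      by (subst nn_integral_cmult_indicator) measurable
    also have "\<dots> \<le> (\<integral>\<^sup>+ y. ennreal (min 1 ((norm y)\<^sup>2)) \<partial>\<nu>)"
    proof (rule nn_integral_mono)
      fix y
      have "c \<le> (norm y)\<^sup>2" if "y \<in> T n"
        unfolding c_def using that by (intro power_mono) (auto simp: T_def)
      then show "ennreal c * indicator (T n) y \<le> ennreal (min 1 ((norm y)\<^sup>2))"
        using c by (auto simp: indicator_def intro!: ennreal_leI)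
    qed
    also have "\<dots> < \<infinity>" using \<nu> by (simp add: levy_measure_def)
    finally show ?thesis using c by (auto simp: ennreal_mult_less_top)
  qed
  have "y \<in> insert 0 (\<Union>n. T n)" for y :: "real ^ 'd"
  proof (cases "y = 0")
    case False
    then obtain n where "inverse (real (Suc n)) < norm y" using reals_Archimedean[of "norm y"] by auto
    then have "y \<in> T n" unfolding T_def inverse_eq_divide by simp
    then show ?thesis by blast
  qed simp
  then have "insert 0 (\<Union>n. T n) = UNIV" by blast
  then have cover: "\<Union> (insert {0} (range T)) = space \<nu>" unfolding sp by simp
  show "\<exists>A. countable A \<and> A \<subseteq> sets \<nu> \<and> \<Union> A = space \<nu> \<and> (\<forall>a\<in>A. emeasure \<nu> a \<noteq> \<infinity>)"
  proof (intro exI[of _ "insert {0} (range T)"] conjI ballI)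
    show "insert {0} (range T) \<subseteq> sets \<nu>" unfolding levy_measure_sets[OF \<nu>] using Tm by (simp add: image_subset_iff)
    show "emeasure \<nu> a \<noteq> \<infinity>" if a: "a \<in> insert {0} (range T)" for a
    proof (cases "a = {0}")
      case False
      then obtain n where "a = T n" using a by blast
      then show ?thesis using fin[of n] by simp
    qed (use \<nu> in \<open>simp add: levy_measure_def\<close>)
    show "countable (insert {0} (range T))" by simp
    show "\<Union> (insert {0} (range T)) = space \<nu>" by (rule cover)
  qed
qed

text \<open>Each test integral is unaffected by changes on a null set. This transfers the perimeter
  bound to a Borel representative.\<close>

lemma perimeter_le_of_AE_eq:
  fixes \<Omega> B :: "(real ^ 'd) set"
  assumes \<Omega>: "\<Omega> \<in> sets lebesgue" and B: "B \<in> sets lebesgue"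
    and eq: "AE x in lebesgue. x \<in> B \<longleftrightarrow> x \<in> \<Omega>"
  shows "perimeter B \<le> perimeter \<Omega>"
  unfolding perimeter_def
proof (rule SUP_mono)
  fix \<phi> :: "real ^ 'd \<Rightarrow> real ^ 'd" assume \<phi>: "\<phi> \<in> {\<phi>. C1_compact_support \<phi> \<and> (\<forall>x. norm (\<phi> x) \<le> 1)}"
  have "continuous_on UNIV (divergence \<phi>)"
    unfolding divergence_def trace_def
    using \<phi> by (intro continuous_intros) (auto simp: C1_compact_support_def)
  then have "divergence \<phi> \<in> borel_measurable borel" by (rule borel_measurable_continuous_onI)
  then have [measurable]: "divergence \<phi> \<in> borel_measurable lebesgue"
    by (intro measurable_completion) simp
  have "(LINT x|lebesgue. indicator B x * divergence \<phi> x) = (LINT x|lebesgue. indicator \<Omega> x * divergence \<phi> x)"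
    using \<Omega> B eq by (intro integral_cong_AE) (auto simp: indicator_def)
  then show "\<exists>\<phi>'\<in>{\<phi>. C1_compact_support \<phi> \<and> (\<forall>x. norm (\<phi> x) \<le> 1)}.
      ereal (LINT x|lebesgue. indicator B x * divergence \<phi> x) \<le> ereal (LINT x|lebesgue. indicator \<Omega> x * divergence \<phi>' x)"
    using \<phi> by (intro bexI[of _ \<phi>]) auto
qed

text \<open>Nonnegative integrals do not change under completion, so both completions disappear.
  Shrinking \<Omega> to \<open>B\<close> only enlarges the complement in the inner integral, and the
  outer integral does not see \<open>N\<close>.\<close>

lemma levy_perimeter_le_borel:
  assumes \<Omega>: "\<Omega> \<subseteq> B \<union> N" "B \<subseteq> \<Omega>" "N \<in> null_sets lborel"
  shows "levy_perimeter \<nu> \<Omega> \<le> (\<integral>\<^sup>+ x. \<integral>\<^sup>+ y. indicator B x * indicator (- B) (x + y) \<partial>\<nu> \<partial>lborel)"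
  unfolding levy_perimeter_def nn_integral_completion
proof (rule nn_integral_mono_AE)
  show "AE x in lborel. (\<integral>\<^sup>+ y. 1 * indicator ((\<lambda>z. z - x) ` (- \<Omega>)) y \<partial>\<nu>) * indicator \<Omega> x
      \<le> (\<integral>\<^sup>+ y. indicator B x * indicator (- B) (x + y) \<partial>\<nu>)"
    using AE_not_in[OF \<Omega>(3)]
  proof eventually_elim
    case (elim x)
    show ?case
    proof (cases "x \<in> \<Omega>")
      case True
      then have "x \<in> B" using elim \<Omega>(1) by blast
      moreover have "x + y \<notin> B" if "y \<in> (\<lambda>z. z - x) ` (- \<Omega>)" for y using that \<Omega>(2) by auto
      ultimately show ?thesis using True
        by (auto simp: indicator_def intro!: nn_integral_mono)
    qed simp
  qed
qed

theorem lemma1: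
  fixes M :: "'w measure"
    and X :: "real \<Rightarrow> 'w \<Rightarrow> real ^ 'd"
    and \<nu> :: "(real ^ 'd) measure"
    and \<Omega> :: "(real ^ 'd) set"
  assumes "levy_process M X"
    and "finite_variation M X"
    and "has_levy_measure M X \<nu>"
    and "\<Omega> \<in> sets lebesgue"
    and "emeasure lebesgue \<Omega> < \<infinity>"
    and "perimeter \<Omega> < \<infinity>"
  shows "levy_perimeter \<nu> \<Omega> < \<infinity>"
proof -
  have \<nu>: "levy_measure \<nu>" using assms(3) by (auto simp: has_levy_measure_def has_levy_triplet_def)
  note [measurable_cong] = levy_measure_sets[OF \<nu>]
  have jumps: "(\<integral>\<^sup>+ y. ennreal (min 1 (norm y)) \<partial>\<nu>) < \<infinity>"
    by (rule levy_process.finite_variation_jump_integrable[OF assms(1-3)])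
  \<comment> \<open>\<open>B\<close> is a Borel subset of \<Omega> that differs from it by a null
    set.\<close>
  obtain B N N' where N: "\<Omega> = B \<union> N" "N \<subseteq> N'" "N' \<in> null_sets lborel" "B \<in> sets lborel"
    using assms(4) by (rule sets_completionE)
  have B [measurable]: "B \<in> sets borel" using N by simp
  have "emeasure lborel B = emeasure lebesgue B" by simp
  also have "\<dots> \<le> emeasure lebesgue \<Omega>" using N assms(4) by (intro emeasure_mono) auto
  finally have finB: "emeasure lborel B < \<infinity>" using assms(5) by simp
  have "AE x in lebesgue. x \<notin> N'" using N(3) by (intro AE_not_in null_sets_completionI)
  then have "AE x in lebesgue. x \<in> B \<longleftrightarrow> x \<in> \<Omega>" by eventually_elim (use N in auto)
  then have "perimeter B < \<infinity>"
    using perimeter_le_of_AE_eq[OF assms(4), of B] assms(6) by (auto intro: le_less_trans)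
  then have "perimeter B \<noteq> \<infinity>" by simp
  then obtain n :: nat where n: "perimeter B < ereal (real n)"
    unfolding less_PInf_Ex_of_nat by (rule exE)
  define P where "P = real n"
  have P: "perimeter B \<le> ereal P" "0 \<le> P" using n by (simp_all add: P_def)
  define m where "m = measure lborel B"
  have m: "emeasure lborel B = ennreal m" "0 \<le> m"
    using finB by (auto simp: m_def intro!: emeasure_eq_ennreal_measure)
  \<comment> \<open>The volume bound \<open>m\<close> is used for |y| > 1 and the perimeter bound
    |y| P for |y| \<le> 1; the constant \<open>m + P\<close> covers both.\<close>
  have exit: "emeasure lborel {x \<in> B. x + y \<notin> B} \<le> ennreal (m + P) * ennreal (min 1 (norm y))" for y
  proof -
    have "emeasure lborel {x \<in> B. x + y \<notin> B} \<le> ennreal m"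
      unfolding m(1)[symmetric] by (intro emeasure_mono) auto
    moreover have "emeasure lborel {x \<in> B. x + y \<notin> B} \<le> ennreal (norm y * P)"
      by (rule emeasure_exit_le_perimeter[OF B finB P(1)])
    ultimately have "emeasure lborel {x \<in> B. x + y \<notin> B} \<le> ennreal (min m (norm y * P))"
      by (simp add: min_def)
    also have "\<dots> \<le> ennreal ((m + P) * min 1 (norm y))"
    proof (rule ennreal_leI)
      show "min m (norm y * P) \<le> (m + P) * min 1 (norm y)"
      proof (cases "norm y \<le> 1")
        case True
        have "norm y * P \<le> (m + P) * norm y" using m(2) by (simp add: algebra_simps)
        then show ?thesis using True by (simp add: min.coboundedI2)
      qed (use P in \<open>simp add: min.coboundedI1\<close>)
    qed
    finally show ?thesis using m P by (simp add: ennreal_mult del: ennreal_plus)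
  qed
  interpret pair_sigma_finite lborel \<nu>
    using levy_measure_sigma_finite[OF \<nu>] by (simp add: pair_sigma_finite_def sigma_finite_lborel)
  \<comment> \<open>After Tonelli the inner integral, for a fixed jump \<open>y\<close>, is the
    measure of the points of \<open>B\<close> which that jump takes out of \<open>B\<close>.\<close>
  have "levy_perimeter \<nu> \<Omega> \<le> (\<integral>\<^sup>+ x. \<integral>\<^sup>+ y. indicator B x * indicator (- B) (x + y) \<partial>\<nu> \<partial>lborel)"
    using N by (intro levy_perimeter_le_borel[of _ _ N']) auto
  also have "\<dots> = (\<integral>\<^sup>+ y. \<integral>\<^sup>+ x. indicator B x * indicator (- B) (x + y) \<partial>lborel \<partial>\<nu>)"
    by (rule Fubini'[symmetric]) measurable
  also have "\<dots> = (\<integral>\<^sup>+ y. emeasure lborel {x \<in> B. x + y \<notin> B} \<partial>\<nu>)"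
  proof (rule nn_integral_cong)
    fix y
    have "{x \<in> B. x + y \<notin> B} \<in> sets lborel" by measurable
    moreover have "(\<lambda>x. indicator B x * indicator (- B) (x + y) :: ennreal) = indicator {x \<in> B. x + y \<notin> B}"
      by (auto simp: indicator_def)
    ultimately show "(\<integral>\<^sup>+ x. indicator B x * indicator (- B) (x + y) \<partial>lborel) = emeasure lborel {x \<in> B. x + y \<notin> B}"
      by simp
  qed
  also have "\<dots> \<le> (\<integral>\<^sup>+ y. ennreal (m + P) * ennreal (min 1 (norm y)) \<partial>\<nu>)"
    by (intro nn_integral_mono exit)
  also have "\<dots> = ennreal (m + P) * (\<integral>\<^sup>+ y. ennreal (min 1 (norm y)) \<partial>\<nu>)"
    by (rule nn_integral_cmult) measurable
  also have "\<dots> < \<infinity>" using jumps by (simp add: ennreal_mult_less_top)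
  finally show ?thesis .
qed

end
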